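(* Let $V$ be a variety of bands (of type $(2)$). Then $V$ is fluid if and only if $V$ is minimal.
   Context: A band is an idempotent semigroup, i.e. an algebra of type $(2)$ (one binary operation, written as juxtaposition) that is associative and satisfies $xx = x$; a variety of bands is a variety of type $(2)$ all of whose members are bands. A hypersubstitution $\sigma$ of type $(2)$ is determined by a choice of a binary term $\sigma(xy)=t(x,y)$ (a term in the variables $x,y$). For an algebra $\mathbf{A}$ of type $(2)$, the derived algebra $\mathbf{A}_\sigma$ has the same universe and its binary operation is the term operation $t^{\mathbf A}$. For a variety $V$ of type $(2)$, the derived variety $V_\sigma$ is the variety of type $(2)$ generated by $\{\mathbf{A}_\sigma : \mathbf{A} \in V\}$; it is proper if $V_\sigma \neq V$. A variety $V$ is fluid if it contains no proper derived variety $V_\sigma$, i.e. for every hypersubstitution $\sigma$, $V_\sigma \subseteq V$ implies $V_\sigma = V$. A variety is trivial if all its algebras are one-element. A variety $V$ is minimal if $V$ is not trivial but the only subvariety of $V$ not equal to $V$ is trivial.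
   Formalization: The variety V is assumed nontrivial: the trivial variety is a variety of bands that is fluid but, by definition, not minimal, so the claim fails for it. Algebras have carriers inside a fixed infinite set, which leaves inclusion and equality of varieties unchanged. *)

theory Defs
  imports Main
begin

datatype 'v trm = Var 'v | Mul "'v trm" "'v trm"

record 'a alg =
  univ :: "'a set"
  op :: "'a \<Rightarrow> 'a \<Rightarrow> 'a"

text \<open>The values of \<^term>\<open>op A\<close> outside \<^term>\<open>univ A\<close> carry no meaning: two records that differ only
  there represent the same algebra, and every variety below contains both or neither.\<close>

definition algebra :: "'a alg \<Rightarrow> bool" where
  "algebra A \<longleftrightarrow> univ A \<noteq> {} \<and> (\<forall>a\<in>univ A. \<forall>b\<in>univ A. op A a b \<in> univ A)"

primrec eval :: "'a alg \<Rightarrow> ('v \<Rightarrow> 'a) \<Rightarrow> 'v trm \<Rightarrow> 'a" where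
  "eval A \<rho> (Var v) = \<rho> v"
| "eval A \<rho> (Mul s t) = op A (eval A \<rho> s) (eval A \<rho> t)"

type_synonym identity = "nat trm \<times> nat trm"

definition satisfies :: "'a alg \<Rightarrow> identity \<Rightarrow> bool" where
  "satisfies A e \<longleftrightarrow> (\<forall>\<rho>. range \<rho> \<subseteq> univ A \<longrightarrow> eval A \<rho> (fst e) = eval A \<rho> (snd e))"

definition models :: "identity set \<Rightarrow> 'a alg set" where
  "models E = {A. algebra A \<and> (\<forall>e\<in>E. satisfies A e)}"

text \<open>The type \<^typ>\<open>'a\<close> plays the role of the set-theoretic universe from which carriers are drawn.
  For infinite \<^typ>\<open>'a\<close>, \<^term>\<open>models E\<close> contains copies of all countable models of \<^term>\<open>E\<close>, hence
  of the free algebra on countably many generators, so it determines the equational theory of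
  \<^term>\<open>E\<close>: inclusion and equality of varieties over \<^typ>\<open>'a\<close> are those of the varieties
  themselves.\<close>

definition variety :: "'a alg set \<Rightarrow> bool" where
  "variety V \<longleftrightarrow> (\<exists>E. V = models E)"

definition generated_variety :: "'a alg set \<Rightarrow> 'a alg set" where
  "generated_variety K = \<Inter>{W. variety W \<and> K \<subseteq> W}"

definition band :: "'a alg \<Rightarrow> bool" where
  "band A \<longleftrightarrow> algebra A
     \<and> (\<forall>a\<in>univ A. \<forall>b\<in>univ A. \<forall>c\<in>univ A. op A (op A a b) c = op A a (op A b c))
     \<and> (\<forall>a\<in>univ A. op A a a = a)"

definition band_variety :: "'a alg set \<Rightarrow> bool" where
  "band_variety V \<longleftrightarrow> variety V \<and> (\<forall>A\<in>V. band A)"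

text \<open>A hypersubstitution is represented by the binary term to which it sends the fundamental
  operation.\<close>

datatype xy = Vx | Vy

type_synonym hypersubst = "xy trm"

definition derived_algebra :: "hypersubst \<Rightarrow> 'a alg \<Rightarrow> 'a alg" where
  "derived_algebra \<sigma> A =
     \<lparr>univ = univ A, op = (\<lambda>a b. eval A (\<lambda>v. case v of Vx \<Rightarrow> a | Vy \<Rightarrow> b) \<sigma>)\<rparr>"

definition derived_variety :: "hypersubst \<Rightarrow> 'a alg set \<Rightarrow> 'a alg set" where
  "derived_variety \<sigma> V = generated_variety (derived_algebra \<sigma> ` V)"

definition fluid :: "'a alg set \<Rightarrow> bool" where
  "fluid V \<longleftrightarrow> (\<forall>\<sigma>. derived_variety \<sigma> V \<subseteq> V \<longrightarrow> derived_variety \<sigma> V = V)"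

definition trivial_variety :: "'a alg set \<Rightarrow> bool" where
  "trivial_variety V \<longleftrightarrow> variety V \<and> (\<forall>A\<in>V. is_singleton (univ A))"

definition minimal_variety :: "'a alg set \<Rightarrow> bool" where
  "minimal_variety V \<longleftrightarrow> variety V \<and> \<not> trivial_variety V
     \<and> (\<forall>W. variety W \<and> W \<subseteq> V \<and> W \<noteq> V \<longrightarrow> trivial_variety W)"

text \<open>The trivial variety is fluid but, by definition, not minimal; it has to be excluded when the
  two notions are compared.\<close>

lemma trivial_variety_fluid_not_minimal:
  assumes "trivial_variety V"
  shows "fluid V" and "\<not> minimal_variety V"
proof -
  have "A \<in> W" if A: "A \<in> V" and W: "variety W" for A and W :: "'a alg set"
  proof -
    obtain E where E: "W = models E" using W by (auto simp: variety_def)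
    have alg: "algebra A" using assms A by (auto simp: trivial_variety_def variety_def models_def)
    obtain x where x: "univ A = {x}"
      using assms A by (auto simp: trivial_variety_def is_singleton_def)
    have "eval A \<rho> t = x" if "range \<rho> \<subseteq> univ A" for \<rho> :: "nat \<Rightarrow> 'a" and t
      using that alg x by (induction t) (auto simp: algebra_def)
    then show ?thesis using alg by (auto simp: E models_def satisfies_def)
  qed
  then show "fluid V"
    by (auto simp: fluid_def derived_variety_def generated_variety_def)
  show "\<not> minimal_variety V" using assms by (simp add: minimal_variety_def)
qed

end

(* Under the hypersubstitution sending xy to x (or to y) every algebra becomes a left (right) zero
   band. If each defining identity of V has the same first letter on both sides, then all these
   derived algebras lie in V, so a fluid V consists of left zero bands; dually for last letters.
   In the remaining case some identity has different first letters and some identity different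
   last letters; substituting a and b and multiplying by ab on the right, respectively by ba on
   the left, gives ab = bab and ba = bab, so V is commutative. A nontrivial left zero band, right
   zero band or semilattice satisfies only those identities that hold in its whole class, so V is
   minimal. Conversely, a derived variety of a nontrivial V is nontrivial because derived
   algebras keep their universe. *)
theory Submission
  imports Defs
begin

section \<open>Generated varieties and derived algebras\<close>

lemma subset_generated_variety: "K \<subseteq> generated_variety K"
  by (auto simp: generated_variety_def)

lemma generated_variety_least: "variety W \<Longrightarrow> K \<subseteq> W \<Longrightarrow> generated_variety K \<subseteq> W"
  by (auto simp: generated_variety_def)

text \<open>Let \<open>E\<close> collect the identities that hold throughout \<open>K\<close>. Every
  variety containing \<open>K\<close> is defined by some subset of \<open>E\<close>, so
  \<open>models E\<close> is the least one and equals the intersection.\<close>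

lemma variety_generated_variety:
  assumes "\<And>A. A \<in> K \<Longrightarrow> algebra A"
  shows "variety (generated_variety K)"
proof -
  define E where "E = {e. \<forall>A\<in>K. satisfies A e}"
  have "K \<subseteq> models E"
    using assms by (auto simp: models_def E_def)
  moreover have "models E \<subseteq> generated_variety K"
    by (fastforce simp: generated_variety_def variety_def models_def E_def)
  ultimately have "generated_variety K = models E"
    by (auto simp: generated_variety_def variety_def)
  then show ?thesis by (auto simp: variety_def)
qed

lemma eval_closed:
  assumes "algebra A" "range \<rho> \<subseteq> univ A"
  shows "eval A \<rho> t \<in> univ A"
  using assms by (induction t) (auto simp: algebra_def)

lemma univ_derived_algebra [simp]: "univ (derived_algebra \<sigma> A) = univ A"
  by (simp add: derived_algebra_def)

lemma algebra_derived_algebra: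
  assumes "algebra A"
  shows "algebra (derived_algebra \<sigma> A)"
proof -
  have "range (case_xy a b) \<subseteq> univ A" if "a \<in> univ A" "b \<in> univ A" for a b
    using that by (auto split: xy.splits)
  then have "eval A (case_xy a b) \<sigma> \<in> univ A" if "a \<in> univ A" "b \<in> univ A" for a b
    using that assms by (intro eval_closed)
  with assms show ?thesis
    by (simp add: algebra_def derived_algebra_def)
qed

section \<open>Fluidity of minimal varieties and a criterion for minimality\<close>

lemma minimal_imp_fluid:
  assumes "minimal_variety V"
  shows "fluid V"
  unfolding fluid_def
proof (intro allI impI)
  fix \<sigma>
  assume sub: "derived_variety \<sigma> V \<subseteq> V"
  have alg: "algebra A" if "A \<in> V" for A
    using assms that by (auto simp: minimal_variety_def variety_def models_def)
  obtain A where A: "A \<in> V" "\<not> is_singleton (univ A)"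
    using assms by (auto simp: minimal_variety_def trivial_variety_def)
  have "derived_algebra \<sigma> A \<in> derived_variety \<sigma> V"
    using A subset_generated_variety by (fastforce simp: derived_variety_def)
  then have "\<not> trivial_variety (derived_variety \<sigma> V)"
    using A by (fastforce simp: trivial_variety_def)
  moreover have "variety (derived_variety \<sigma> V)"
    unfolding derived_variety_def
    by (rule variety_generated_variety) (auto intro: algebra_derived_algebra alg)
  ultimately show "derived_variety \<sigma> V = V"
    using assms sub by (auto simp: minimal_variety_def)
qed

text \<open>If a subvariety has a nontrivial member, \<open>transfer\<close> carries its defining
  identities from that member to all of \<open>V\<close>, so the subvariety is
  \<open>V\<close>.\<close>

lemma minimal_varietyI:
  assumes "variety V" "\<not> trivial_variety V" "V \<subseteq> K"
    and transfer: "\<And>A B e. A \<in> K \<Longrightarrow> B \<in> K \<Longrightarrow> \<not> is_singleton (univ A) \<Longrightarrow> satisfies A e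
      \<Longrightarrow> satisfies B e"
  shows "minimal_variety V"
  unfolding minimal_variety_def
proof (intro conjI allI impI)
  fix W
  assume W: "variety W \<and> W \<subseteq> V \<and> W \<noteq> V"
  show "trivial_variety W"
  proof (rule ccontr)
    assume "\<not> trivial_variety W"
    then obtain A where A: "A \<in> W" "\<not> is_singleton (univ A)"
      using W by (auto simp: trivial_variety_def)
    obtain E where E: "W = models E" using W by (auto simp: variety_def)
    have "B \<in> W" if "B \<in> V" for B
    proof -
      have "algebra B" using that assms(1) by (auto simp: variety_def models_def)
      moreover have "satisfies B e" if "e \<in> E" for e
        by (rule transfer[of A]) (use A W E \<open>B \<in> V\<close> \<open>e \<in> E\<close> assms(3) in \<open>auto simp: models_def\<close>)
      ultimately show ?thesis by (auto simp: E models_def)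
    qed
    then show False using W by auto
  qed
qed (use assms in auto)

lemma not_singletonE:
  assumes "algebra A" "\<not> is_singleton (univ A)"
  obtains a b where "a \<in> univ A" "b \<in> univ A" "a \<noteq> b"
  using assms by (metis algebra_def is_singletonI')

subsection \<open>Projection algebras\<close>

text \<open>The type \<open>xy\<close> doubles as a choice of side: \<open>Vx\<close> gives the
  first letter of a term and \<open>Vy\<close> the last, so that dual arguments are made once. The
  matching hypersubstitution is \<open>Var p\<close>.\<close>

primrec end_var :: "xy \<Rightarrow> 'v trm \<Rightarrow> 'v" where
  "end_var p (Var v) = v"
| "end_var p (Mul s t) = (case p of Vx \<Rightarrow> end_var p s | Vy \<Rightarrow> end_var p t)"

text \<open>These are the left zero bands for \<open>Vx\<close> and the right zero bands for
  \<open>Vy\<close>.\<close>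

definition projection_algebra :: "xy \<Rightarrow> 'a alg \<Rightarrow> bool" where
  "projection_algebra p A \<longleftrightarrow> algebra A
     \<and> (\<forall>a\<in>univ A. \<forall>b\<in>univ A. op A a b = (case p of Vx \<Rightarrow> a | Vy \<Rightarrow> b))"

lemma projection_algebra_derived: "algebra A \<Longrightarrow> projection_algebra p (derived_algebra (Var p) A)"
  using algebra_derived_algebra[of A "Var p"]
  by (simp add: projection_algebra_def) (simp add: derived_algebra_def)

lemma eval_projection_algebra:
  assumes "projection_algebra p A" "range \<rho> \<subseteq> univ A"
  shows "eval A \<rho> t = \<rho> (end_var p t)"
proof (induction t)
  case (Mul s t)
  have "\<rho> v \<in> univ A" for v using assms(2) by auto
  with Mul assms(1) show ?case by (auto simp: projection_algebra_def split: xy.splits)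
qed simp

lemma satisfies_projection_algebraI:
  assumes "projection_algebra p A" "end_var p (fst e) = end_var p (snd e)"
  shows "satisfies A e"
  using assms by (auto simp: satisfies_def eval_projection_algebra)

text \<open>Together with \<open>satisfies_projection_algebraI\<close>, this shows that all
  nontrivial projection algebras of one side have the same identities, as
  \<open>minimal_varietyI\<close> requires.\<close>

lemma satisfies_projection_algebraD:
  assumes "projection_algebra p A" "\<not> is_singleton (univ A)" "satisfies A e"
  shows "end_var p (fst e) = end_var p (snd e)"
proof (rule ccontr)
  assume neq: "end_var p (fst e) \<noteq> end_var p (snd e)"
  have "algebra A" using assms(1) by (simp add: projection_algebra_def)
  then obtain a b where ab: "a \<in> univ A" "b \<in> univ A" "a \<noteq> b"
    using assms(2) by (rule not_singletonE)
  define \<rho> where "\<rho> v = (if v = end_var p (fst e) then a else b)" for v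
  have "range \<rho> \<subseteq> univ A" using ab by (auto simp: \<rho>_def)
  with assms have "\<rho> (end_var p (fst e)) = \<rho> (end_var p (snd e))"
    by (metis satisfies_def eval_projection_algebra)
  then show False using ab neq by (auto simp: \<rho>_def)
qed

text \<open>This bounds \<open>derived_variety (Var p) V\<close> from above: a generated variety
  lies in every variety that contains its generators.\<close>

lemma variety_projection_algebras: "variety {A. projection_algebra p A}"
proof -
  define e :: identity where
    "e = (Mul (Var 0) (Var 1), Var (case p of Vx \<Rightarrow> 0 | Vy \<Rightarrow> 1))"
  have "projection_algebra p A" if "A \<in> models {e}" for A :: "'a alg"
    unfolding projection_algebra_def
  proof (intro conjI ballI)
    show "algebra A" using that by (simp add: models_def)
    fix a b assume "a \<in> univ A" "b \<in> univ A"
    then have "range (\<lambda>v::nat. if v = 0 then a else b) \<subseteq> univ A" by auto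
    moreover have "satisfies A e" using that by (simp add: models_def)
    ultimately have "eval A (\<lambda>v. if v = 0 then a else b) (fst e)
        = eval A (\<lambda>v. if v = 0 then a else b) (snd e)"
      unfolding satisfies_def by blast
    then show "op A a b = (case p of Vx \<Rightarrow> a | Vy \<Rightarrow> b)"
      by (simp add: e_def split: xy.splits)
  qed
  moreover have "A \<in> models {e}" if "projection_algebra p A" for A :: "'a alg"
  proof -
    have "satisfies A e"
      using that by (rule satisfies_projection_algebraI) (simp add: e_def split: xy.splits)
    with that show ?thesis by (simp add: models_def projection_algebra_def)
  qed
  ultimately show ?thesis unfolding variety_def by blast
qed

lemma minimal_variety_projection_algebras:
  assumes "variety V" "\<not> trivial_variety V" "V \<subseteq> {A. projection_algebra p A}"
  shows "minimal_variety V"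
  using assms
proof (rule minimal_varietyI)
  fix A B :: "'a alg" and e
  assume "A \<in> {A. projection_algebra p A}" "B \<in> {A. projection_algebra p A}"
    "\<not> is_singleton (univ A)" "satisfies A e"
  then show "satisfies B e"
    using satisfies_projection_algebraI satisfies_projection_algebraD by blast
qed

text \<open>Equal end letters in \<open>E\<close> put every projection algebra into
  \<open>V\<close>, in particular those derived by \<open>Var p\<close>. Fluidity then makes
  \<open>V\<close> the variety that these generate.\<close>

lemma fluid_imp_projection_algebras:
  assumes E: "V = models E" and fluid: "fluid V"
    and ends: "\<And>e. e \<in> E \<Longrightarrow> end_var p (fst e) = end_var p (snd e)"
  shows "V \<subseteq> {A. projection_algebra p A}"
proof -
  let ?D = "derived_algebra (Var p) ` V"
  have proj: "?D \<subseteq> {A. projection_algebra p A}"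
    using projection_algebra_derived by (fastforce simp: E models_def)
  have "A \<in> V" if "projection_algebra p A" for A
    using that ends satisfies_projection_algebraI[OF that]
    by (simp add: E models_def projection_algebra_def)
  with proj have "?D \<subseteq> V" by blast
  then have "derived_variety (Var p) V \<subseteq> V"
    unfolding derived_variety_def by (intro generated_variety_least) (auto simp: E variety_def)
  then have "V = derived_variety (Var p) V"
    using fluid unfolding fluid_def by blast
  also have "\<dots> \<subseteq> {A. projection_algebra p A}"
    unfolding derived_variety_def
    by (rule generated_variety_least[OF variety_projection_algebras proj])
  finally show ?thesis .
qed

subsection \<open>Semilattices\<close>

definition semilattice_algebra :: "'a alg \<Rightarrow> bool" where
  "semilattice_algebra A \<longleftrightarrow> band A \<and> (\<forall>a\<in>univ A. \<forall>b\<in>univ A. op A a b = op A b a)"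

section \<open>Terms evaluated at two elements of a band\<close>

context
  fixes A :: "'a alg"
  assumes band: "band A"
begin

lemma band_algebra: "algebra A"
  using band by (simp add: band_def)

lemma band_closed: "a \<in> univ A \<Longrightarrow> b \<in> univ A \<Longrightarrow> op A a b \<in> univ A"
  using band_algebra by (simp add: algebra_def)

lemma band_assoc:
  "a \<in> univ A \<Longrightarrow> b \<in> univ A \<Longrightarrow> c \<in> univ A \<Longrightarrow> op A (op A a b) c = op A a (op A b c)"
  using band by (simp add: band_def)

lemma band_idem: "a \<in> univ A \<Longrightarrow> op A a a = a"
  using band by (simp add: band_def)

lemma band_idem_left: "a \<in> univ A \<Longrightarrow> b \<in> univ A \<Longrightarrow> op A a (op A a b) = op A a b"
  by (metis band_assoc band_idem)

text \<open>This is (ab)(ab) = ab with the brackets moved to the right.\<close>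

lemma band_alternating:
  "a \<in> univ A \<Longrightarrow> b \<in> univ A \<Longrightarrow> op A a (op A b (op A a b)) = op A a b"
  by (metis band_assoc band_closed band_idem)

text \<open>Left multiplication by a sends both ab and bab to ab, and by b sends both to bab. Only
  the letter applied last, the first letter of the term, matters. Letting \<open>z\<close> be either
  element carries the induction through products.\<close>

lemma eval_mult_left:
  assumes ab: "a \<in> univ A" "b \<in> univ A" and \<rho>: "range \<rho> \<subseteq> {a, b}"
    and z: "z \<in> {op A a b, op A b (op A a b)}"
  shows "op A (eval A \<rho> t) z = op A (\<rho> (end_var Vx t)) (op A a b)"
  using z
proof (induction t arbitrary: z)
  case (Var v)
  have "\<rho> v \<in> {a, b}" using \<rho> by auto
  with Var ab show ?case
    by (auto simp: band_closed band_idem_left band_alternating)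
next
  case (Mul s t)
  have "range \<rho> \<subseteq> univ A" "z \<in> univ A" "\<rho> (end_var Vx t) \<in> {a, b}"
    using \<rho> ab Mul.prems by (auto simp: band_closed)
  moreover have "op A (\<rho> (end_var Vx t)) (op A a b) \<in> {op A a b, op A b (op A a b)}"
    using \<open>\<rho> (end_var Vx t) \<in> {a, b}\<close> ab by (auto simp: band_idem_left)
  ultimately show ?case
    using Mul by (simp add: band_assoc eval_closed[OF band_algebra])
qed

text \<open>The mirror image, with ba in place of ab. The element bab is its own mirror image and so
  links the two results.\<close>

lemma eval_mult_right:
  assumes ab: "a \<in> univ A" "b \<in> univ A" and \<rho>: "range \<rho> \<subseteq> {a, b}"
    and z: "z \<in> {op A b a, op A b (op A a b)}"
  shows "op A z (eval A \<rho> t) = op A (op A b a) (\<rho> (end_var Vy t))"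
  using z
proof (induction t arbitrary: z)
  case (Var v)
  have "\<rho> v \<in> {a, b}" using \<rho> by auto
  with Var ab show ?case
    by (auto simp: band_closed band_assoc band_idem band_alternating)
next
  case (Mul s t)
  have "range \<rho> \<subseteq> univ A" "z \<in> univ A" "\<rho> (end_var Vy s) \<in> {a, b}"
    using \<rho> ab Mul.prems by (auto simp: band_closed)
  moreover have "op A (op A b a) (\<rho> (end_var Vy s)) \<in> {op A b a, op A b (op A a b)}"
    using \<open>\<rho> (end_var Vy s) \<in> {a, b}\<close> ab by (auto simp: band_assoc band_idem)
  ultimately show ?case
    using Mul by (simp flip: band_assoc add: eval_closed[OF band_algebra])
qed

lemma semilattice_if_end_vars_differ:
  assumes e: "satisfies A e" "end_var Vx (fst e) \<noteq> end_var Vx (snd e)"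
    and f: "satisfies A f" "end_var Vy (fst f) \<noteq> end_var Vy (snd f)"
  shows "semilattice_algebra A"
  unfolding semilattice_algebra_def
proof (intro conjI ballI)
  show "band A" by (fact band)
  fix a b assume ab: "a \<in> univ A" "b \<in> univ A"
  \<comment> \<open>The first letters of the two sides of \<open>e\<close> get the values a and b
    respectively; \<open>\<tau>\<close> does the same for the last letters of
    \<open>f\<close>.\<close>
  define \<rho> where "\<rho> v = (if v = end_var Vx (fst e) then a else b)" for v
  define \<tau> where "\<tau> v = (if v = end_var Vy (fst f) then a else b)" for v
  have "range \<rho> \<subseteq> univ A" "range \<tau> \<subseteq> univ A"
    using ab by (auto simp: \<rho>_def \<tau>_def)
  then have eqs: "eval A \<rho> (fst e) = eval A \<rho> (snd e)" "eval A \<tau> (fst f) = eval A \<tau> (snd f)"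
    using e(1) f(1) by (auto simp: satisfies_def)
  have "op A (eval A \<rho> t) (op A a b) = op A (\<rho> (end_var Vx t)) (op A a b)" for t
    using ab by (intro eval_mult_left) (auto simp: \<rho>_def)
  with eqs(1) have "op A (\<rho> (end_var Vx (fst e))) (op A a b)
      = op A (\<rho> (end_var Vx (snd e))) (op A a b)"
    by metis
  \<comment> \<open>The equation before reads a(ab) = b(ab), and a(ab) = ab.\<close>
  then have ab_eq: "op A a b = op A b (op A a b)"
    using e(2) ab by (simp add: \<rho>_def band_idem_left)
  have "op A (op A b a) (eval A \<tau> t) = op A (op A b a) (\<tau> (end_var Vy t))" for t
    using ab by (intro eval_mult_right) (auto simp: \<tau>_def)
  with eqs(2) have "op A (op A b a) (\<tau> (end_var Vy (fst f)))
      = op A (op A b a) (\<tau> (end_var Vy (snd f)))"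
    by metis
  then have "op A b a = op A b (op A a b)"
    using f(2) ab by (simp add: \<tau>_def band_assoc band_idem)
  with ab_eq show "op A a b = op A b a" by simp
qed

end

section \<open>Identities of semilattices\<close>

context
  fixes A :: "'a alg"
  assumes sl: "semilattice_algebra A"
begin

lemma semilattice_band: "band A"
  using sl by (simp add: semilattice_algebra_def)

lemma semilattice_comm: "a \<in> univ A \<Longrightarrow> b \<in> univ A \<Longrightarrow> op A a b = op A b a"
  using sl by (simp add: semilattice_algebra_def)

lemmas semilattice_simps =
  band_closed[OF semilattice_band] band_assoc[OF semilattice_band] band_idem[OF semilattice_band]
  band_idem_left[OF semilattice_band] eval_closed[OF band_algebra[OF semilattice_band]]

text \<open>Commutativity moves \<open>\<rho> v\<close> to a factor that contains \<open>v\<close>.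
  In the semilattice order, a term evaluates to the meet of its variables.\<close>

lemma eval_absorbs_var:
  assumes \<rho>: "range \<rho> \<subseteq> univ A" and "v \<in> set_trm t"
  shows "op A (\<rho> v) (eval A \<rho> t) = eval A \<rho> t"
  using assms(2)
proof (induction t)
  case (Var w)
  have "\<rho> w \<in> univ A" using \<rho> by auto
  with Var show ?case by (simp add: semilattice_simps)
next
  case (Mul s t)
  have mem: "\<rho> v \<in> univ A" "eval A \<rho> s \<in> univ A" "eval A \<rho> t \<in> univ A"
    using \<rho> by (auto simp: semilattice_simps)
  from Mul.prems consider "v \<in> set_trm s" | "v \<in> set_trm t" by auto
  then show ?case
  proof cases
    case 1
    then show ?thesis using Mul.IH(1) mem by (simp flip: band_assoc[OF semilattice_band])
  next
    case 2
    have "op A (\<rho> v) (op A (eval A \<rho> s) (eval A \<rho> t))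
        = op A (eval A \<rho> s) (op A (\<rho> v) (eval A \<rho> t))"
      using mem by (metis semilattice_comm band_assoc[OF semilattice_band])
    then show ?thesis using Mul.IH(2) 2 by simp
  qed
qed

lemma eval_absorbs:
  assumes \<rho>: "range \<rho> \<subseteq> univ A" and "set_trm s \<subseteq> set_trm t"
  shows "op A (eval A \<rho> s) (eval A \<rho> t) = eval A \<rho> t"
  using assms(2) by (induction s) (simp_all add: eval_absorbs_var \<rho> semilattice_simps)

text \<open>Each side absorbs the other, so both equal their common product: antisymmetry of the
  semilattice order.\<close>

lemma satisfies_semilatticeI:
  assumes "set_trm (fst e) = set_trm (snd e)"
  shows "satisfies A e"
  unfolding satisfies_def
proof (intro allI impI)
  fix \<rho> :: "nat \<Rightarrow> 'a" assume \<rho>: "range \<rho> \<subseteq> univ A"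
  show "eval A \<rho> (fst e) = eval A \<rho> (snd e)"
    using eval_absorbs[OF \<rho>, of "fst e" "snd e"] eval_absorbs[OF \<rho>, of "snd e" "fst e"]
      semilattice_comm[of "eval A \<rho> (fst e)" "eval A \<rho> (snd e)"] assms
    by (simp add: semilattice_simps \<rho>)
qed

lemma satisfies_semilatticeD:
  assumes "\<not> is_singleton (univ A)" "satisfies A e"
  shows "set_trm (fst e) = set_trm (snd e)"
proof -
  obtain a b where ab: "a \<in> univ A" "b \<in> univ A" "a \<noteq> b"
    using not_singletonE[OF band_algebra[OF semilattice_band] assms(1)] .
  \<comment> \<open>As a and b differ, at least one of them is not ab. Calling it \<open>d\<close>
    gives a two-element chain with \<open>c\<close> as its zero.\<close>
  define c where "c = op A a b"
  define d where "d = (if a = c then b else a)"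
  have cd: "c \<in> univ A" "d \<in> univ A" "c \<noteq> d"
    using ab by (auto simp: c_def d_def semilattice_simps)
  have dc: "op A d c = c"
    using ab by (auto simp: c_def d_def semilattice_simps)
      (metis semilattice_comm)+
  then have cd': "op A c d = c" using cd semilattice_comm by metis
  show ?thesis
  proof (rule set_eqI)
    fix v
    \<comment> \<open>With the zero \<open>c\<close> at \<open>v\<close> and \<open>d\<close>
      elsewhere, the value of a term tells whether \<open>v\<close> occurs in it.\<close>
    define \<rho> where "\<rho> w = (if w = v then c else d)" for w :: nat
    have "eval A \<rho> t = (if v \<in> set_trm t then c else d)" for t
      by (induction t) (use cd dc cd' in \<open>auto simp: \<rho>_def semilattice_simps\<close>)
    moreover have "range \<rho> \<subseteq> univ A"
      using cd by (auto simp: \<rho>_def)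
    then have "eval A \<rho> (fst e) = eval A \<rho> (snd e)"
      using assms(2) by (simp add: satisfies_def)
    ultimately show "v \<in> set_trm (fst e) \<longleftrightarrow> v \<in> set_trm (snd e)"
      using cd(3) by (metis (full_types))
  qed
qed

end

lemma minimal_variety_semilattices:
  assumes "variety V" "\<not> trivial_variety V" "V \<subseteq> {A. semilattice_algebra A}"
  shows "minimal_variety V"
  using assms
proof (rule minimal_varietyI)
  fix A B :: "'a alg" and e
  assume "A \<in> {A. semilattice_algebra A}" "B \<in> {A. semilattice_algebra A}"
    "\<not> is_singleton (univ A)" "satisfies A e"
  then show "satisfies B e"
    using satisfies_semilatticeI satisfies_semilatticeD by blast
qed

section \<open>The equivalence for bands\<close>

theorem theorem1p6:
  fixes V :: "'a alg set"
  assumes "infinite (UNIV :: 'a set)"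
    and "band_variety V"
    and "\<not> trivial_variety V"
  shows "fluid V \<longleftrightarrow> minimal_variety V"
proof
  assume fluid: "fluid V"
  have V: "variety V" and band: "\<And>A. A \<in> V \<Longrightarrow> band A"
    using assms(2) by (auto simp: band_variety_def)
  obtain E where E: "V = models E" using V by (auto simp: variety_def)
  show "minimal_variety V"
  proof (cases "\<exists>p. \<forall>e\<in>E. end_var p (fst e) = end_var p (snd e)")
    case True
    then obtain p where "\<And>e. e \<in> E \<Longrightarrow> end_var p (fst e) = end_var p (snd e)" by blast
    then have "V \<subseteq> {A. projection_algebra p A}"
      by (intro fluid_imp_projection_algebras[OF E fluid])
    with V assms(3) show ?thesis by (rule minimal_variety_projection_algebras)
  next
    case False
    \<comment> \<open>The negated condition is used once for each side; \<open>e\<close> and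
      \<open>f\<close> may coincide.\<close>
    then obtain e f where e: "e \<in> E" "end_var Vx (fst e) \<noteq> end_var Vx (snd e)"
      and f: "f \<in> E" "end_var Vy (fst f) \<noteq> end_var Vy (snd f)"
      by meson
    have "semilattice_algebra A" if "A \<in> V" for A
      using that e f band[OF that]
      by (intro semilattice_if_end_vars_differ[of A e f]) (auto simp: E models_def)
    then have "V \<subseteq> {A. semilattice_algebra A}" by blast
    with V assms(3) show ?thesis by (rule minimal_variety_semilattices)
  qed
qed (rule minimal_imp_fluid)

end
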